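(* For every graph $G$ and every positive integer $k$ with $k\equiv 0\pmod 4$, $$\gamma_{\rm sp}(S_k(G)) = \frac{k}{2}\, m(G)+\gamma_{\rm sp}(G).$$
   Context: All graphs are finite, simple and undirected. $m(G)$ denotes the number of edges of $G$. For an integer $k\ge 1$, the $k$-subdivision $S_k(G)$ of $G$ is the graph obtained from $G$ by replacing each edge with a disjoint path of length $k+1$, that is, by subdividing each edge exactly $k$ times. For $D\subseteq V(G)$ write $\overline{D}=V(G)\setminus D$, and let $N_G(v)$ be the open neighborhood of $v$. A set $D\subseteq V(G)$ is a dominating set if every vertex of $\overline{D}$ has a neighbor in $D$. A dominating set $D$ is a super dominating set if for every $x\in\overline{D}$ there exists $y\in D$ such that $N_G(y)\cap\overline{D}=\{x\}$. The super domination number $\gamma_{\rm sp}(G)$ is the minimum cardinality of a super dominating set of $G$. *)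

theory Defs
  imports "HOL-Number_Theory.Cong"
begin

record 'a graph =
  verts :: "'a set"
  edges :: "'a set set"

definition finite_simple_graph :: "'a graph \<Rightarrow> bool" where
  "finite_simple_graph G \<longleftrightarrow>
     finite (verts G) \<and> (\<forall>e \<in> edges G. e \<subseteq> verts G \<and> card e = 2)"

definition nbhd :: "'a graph \<Rightarrow> 'a \<Rightarrow> 'a set" where
  "nbhd G v = {w \<in> verts G. {v, w} \<in> edges G}"

definition dominating_set :: "'a graph \<Rightarrow> 'a set \<Rightarrow> bool" where
  "dominating_set G D \<longleftrightarrow>
     D \<subseteq> verts G \<and> (\<forall>x \<in> verts G - D. nbhd G x \<inter> D \<noteq> {})"

definition super_dominating_set :: "'a graph \<Rightarrow> 'a set \<Rightarrow> bool" where
  "super_dominating_set G D \<longleftrightarrow>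
     dominating_set G D \<and>
     (\<forall>x \<in> verts G - D. \<exists>y \<in> D. nbhd G y \<inter> (verts G - D) = {x})"

definition super_domination_number :: "'a graph \<Rightarrow> nat" where
  "super_domination_number G = Min (card ` {D. super_dominating_set G D})"

text \<open>
  The new vertex on an edge \<open>{u, v}\<close> at distance \<open>i\<close> from \<open>u\<close>, hence at distance
  \<open>k + 1 - i\<close> from \<open>v\<close>, is encoded by the unordered pair \<open>{(u, i), (v, k + 1 - i)}\<close>.
  So no orientation of the edges has to be chosen, and different edges have disjoint sets of
  new vertices.
\<close>

datatype 'a subdiv_vertex = Old 'a | New "('a \<times> nat) set"

definition path_vertex :: "nat \<Rightarrow> 'a \<Rightarrow> 'a \<Rightarrow> nat \<Rightarrow> 'a subdiv_vertex" where
  "path_vertex k u v i =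
     (if i = 0 then Old u
      else if i = k + 1 then Old v
      else New {(u, i), (v, k + 1 - i)})"

definition subdivision :: "nat \<Rightarrow> 'a graph \<Rightarrow> 'a subdiv_vertex graph" where
  "subdivision k G =
     \<lparr> verts = Old ` verts G \<union>
               {path_vertex k u v i | u v i. {u, v} \<in> edges G \<and> 1 \<le> i \<and> i \<le> k},
       edges = {{path_vertex k u v i, path_vertex k u v (Suc i)} | u v i.
                  {u, v} \<in> edges G \<and> i \<le> k} \<rparr>"

lemma path_vertex_reverse:
  assumes "i \<le> k + 1"
  shows "path_vertex k v u (k + 1 - i) = path_vertex k u v i"
  using assms by (auto simp: path_vertex_def insert_commute)

lemma path_vertex_inject:
  assumes "u \<noteq> v" "u' \<noteq> v'" "1 \<le> i" "i \<le> k" "1 \<le> j" "j \<le> k"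
  shows "path_vertex k u v i = path_vertex k u' v' j \<longleftrightarrow>
           u = u' \<and> v = v' \<and> i = j \<or> u = v' \<and> v = u' \<and> j = k + 1 - i"
  using assms by (auto simp: path_vertex_def doubleton_eq_iff)

lemma super_domination_number_attained:
  assumes "finite_simple_graph G"
  obtains D where "super_dominating_set G D" "card D = super_domination_number G"
proof -
  have "{D. super_dominating_set G D} \<subseteq> Pow (verts G)"
    by (auto simp: super_dominating_set_def dominating_set_def)
  then have "finite {D. super_dominating_set G D}"
    using assms finite_subset by (auto simp: finite_simple_graph_def)
  moreover have "super_dominating_set G (verts G)"
    by (auto simp: super_dominating_set_def dominating_set_def)
  ultimately have "super_domination_number G \<in> card ` {D. super_dominating_set G D}"
    unfolding super_domination_number_def by (intro Min_in) auto
  then show thesis using that by auto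
qed

lemma finite_simple_graph_subdivision:
  assumes "finite_simple_graph G"
  shows "finite_simple_graph (subdivision k G)"
proof -
  have inV: "u \<in> verts G" "v \<in> verts G" "u \<noteq> v" if "{u, v} \<in> edges G" for u v
    using assms that by (force simp: finite_simple_graph_def card_2_iff)+
  have "{path_vertex k u v i | u v i. {u, v} \<in> edges G \<and> 1 \<le> i \<and> i \<le> k}
      \<subseteq> (\<lambda>(u, v, i). path_vertex k u v i) ` (verts G \<times> verts G \<times> {..k})"
    using inV by force
  then have "finite {path_vertex k u v i | u v i. {u, v} \<in> edges G \<and> 1 \<le> i \<and> i \<le> k}"
    by (rule finite_subset) (use assms in \<open>simp add: finite_simple_graph_def\<close>)
  then have fin: "finite (verts (subdivision k G))"
    using assms by (simp add: subdivision_def finite_simple_graph_def)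
  have mem: "path_vertex k u v i \<in> verts (subdivision k G)"
    if "{u, v} \<in> edges G" "i \<le> k + 1" for u v i
  proof (cases "i = 0 \<or> i = k + 1")
    case True
    then show ?thesis
      using inV[OF that(1)] by (auto simp: subdivision_def path_vertex_def)
  next
    case False
    with that have "1 \<le> i" "i \<le> k" by auto
    with that(1) show ?thesis by (auto simp: subdivision_def)
  qed
  have "path_vertex k u v i \<noteq> path_vertex k u v (Suc i)" if "{u, v} \<in> edges G" for u v i
    using inV(3)[OF that] by (auto simp: path_vertex_def doubleton_eq_iff)
  moreover have "\<exists>u v i. e = {path_vertex k u v i, path_vertex k u v (Suc i)}
                   \<and> {u, v} \<in> edges G \<and> i \<le> k"
    if "e \<in> edges (subdivision k G)" for e
    using that by (simp add: subdivision_def)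
  ultimately have "e \<subseteq> verts (subdivision k G) \<and> card e = 2"
    if "e \<in> edges (subdivision k G)" for e
    using that mem by fastforce
  with fin show ?thesis by (simp add: finite_simple_graph_def)
qed

end

theory Submission
  imports Defs
begin

text \<open>
  The complement of a super dominating set is a set each of whose members has a private neighbour
  outside the set, so the theorem says that the largest such set \<open>X\<close> grows by \<open>k / 2\<close> per edge.
  To extend \<open>X\<close> to the subdivision, with \<open>f u\<close> the private neighbour of \<open>u\<close>, select on the path
  from \<open>u\<close> to \<open>v\<close> the positions congruent to 2, 3 modulo 4 if neither end is in \<open>X\<close>, to 3, 0 if
  \<open>f u = v\<close>, to 1, 2 if \<open>f v = u\<close>, and to 0, 1 otherwise.

  Conversely, a private set of the subdivision contains at most two of any four consecutive inner
  vertices, hence at most \<open>k / 2\<close> on each edge; the difference is the deficit of the edge. Let \<open>A\<close> be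
  the old vertices in the set, and for \<open>u\<close> in \<open>A\<close> let \<open>uv\<close> with \<open>v = h u\<close> be the edge that carries
  the private neighbour of \<open>u\<close>. On an edge without deficit the pattern is rigid: if \<open>v = h u\<close> it is
  0011...0011, so \<open>v\<close> is the private neighbour of the last inner vertex, and every other edge from
  \<open>A\<close> to \<open>v\<close> must have a deficit. Removing from \<open>A\<close> one vertex per unit of deficit therefore leaves
  a private set of the original graph, with \<open>h u\<close> as the private neighbour of \<open>u\<close>.
\<close>

section \<open>Counting positions of a path in blocks of four\<close>

lemma card_block_Suc:
  fixes x :: "nat \<Rightarrow> bool"
  shows "card {i \<in> {s<..s + 4 * Suc q}. x i} =
    of_bool (x (s + 1)) + of_bool (x (s + 2)) + of_bool (x (s + 3)) + of_bool (x (s + 4))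
    + card {i \<in> {s + 4<..s + 4 + 4 * q}. x i}"
proof -
  have *: "card {i \<in> A. x i} = (\<Sum>i\<in>A. of_bool (x i))" if "finite A" for A
    using that by (simp add: Int_def)
  have "{s<..s + 4 * Suc q} = {s + 1, s + 2, s + 3, s + 4} \<union> {s + 4<..s + 4 + 4 * q}"
    by auto
  then show ?thesis
    by (subst (1 2) *) (simp_all add: sum.union_disjoint)
qed

lemma card_periodic:
  fixes P :: "nat \<Rightarrow> bool"
  shows "card {i \<in> {0<..4 * q}. P (i mod 4)} =
    q * (of_bool (P 0) + of_bool (P 1) + of_bool (P 2) + of_bool (P 3))"
proof -
  \<comment> \<open>Starting at an arbitrary multiple of four lets the induction remove the first
    block.\<close>
  have "card {i \<in> {4 * r<..4 * r + 4 * q}. P (i mod 4)} =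
    q * (of_bool (P 0) + of_bool (P 1) + of_bool (P 2) + of_bool (P 3))" for r
  proof (induction q arbitrary: r)
    case (Suc q)
    have m: "(4 * r + 1) mod 4 = 1" "(4 * r + 2) mod 4 = 2" "(4 * r + 3) mod 4 = 3"
      "(4 * r + 4) mod 4 = 0" by presburger+
    show ?case
      unfolding card_block_Suc m using Suc[of "Suc r"] by (simp add: add.commute algebra_simps)
  qed simp
  from this[of 0] show ?thesis by simp
qed

text \<open>Three selected positions in a block of four include a middle one that is left with no
  private neighbour, so each block holds at most two. The guards drop conditions on positions
  outside the window; this keeps the hypothesis stable when the first block is removed.\<close>

lemma card_window_le:
  fixes x :: "nat \<Rightarrow> bool"
  assumes "\<And>i. s < i \<Longrightarrow> i + 3 \<le> s + 4 * q + 1 \<Longrightarrow> x (Suc i) \<Longrightarrow>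
      \<not> x i \<and> (s + 1 < i \<longrightarrow> \<not> x (i - 1)) \<or>
      \<not> x (i + 2) \<and> (i + 3 \<le> s + 4 * q \<longrightarrow> \<not> x (i + 3))"
  shows "card {i \<in> {s<..s + 4 * q}. x i} \<le> 2 * q"
  using assms
proof (induction q arbitrary: s)
  case (Suc q)
  have "card {i \<in> {s + 4<..s + 4 + 4 * q}. x i} \<le> 2 * q"
  proof (rule Suc.IH)
    fix i assume "s + 4 < i" "i + 3 \<le> s + 4 + 4 * q + 1" "x (Suc i)"
    then show "\<not> x i \<and> (s + 4 + 1 < i \<longrightarrow> \<not> x (i - 1)) \<or>
      \<not> x (i + 2) \<and> (i + 3 \<le> s + 4 + 4 * q \<longrightarrow> \<not> x (i + 3))"
      using Suc.prems[of i] by auto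
  qed
  moreover have "of_bool (x (s + 1)) + of_bool (x (s + 2)) + of_bool (x (s + 3))
      + of_bool (x (s + 4)) \<le> (2 :: nat)"
    using Suc.prems[of "s + 1"] Suc.prems[of "s + 2"]
    by (auto simp: of_bool_def numeral_eq_Suc)
  ultimately show ?case
    unfolding card_block_Suc by simp
qed simp

text \<open>The construction seeks the private neighbour one step to the left or right. These
  residue facts describe the positions one and two steps away and, with \<open>mod_4_le\<close>,
  keep them on the path.\<close>

lemma mod_4_pred:
  fixes i :: nat
  shows "i mod 4 = 2 \<Longrightarrow> 2 \<le> i \<and> (i - 2) mod 4 = 0 \<and> (i - 1) mod 4 = 1"
    and "i mod 4 = 3 \<Longrightarrow> 3 \<le> i \<and> (i - 2) mod 4 = 1 \<and> (i - 1) mod 4 = 2"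
    and "i mod 4 = 0 \<Longrightarrow> 0 < i \<Longrightarrow> 3 \<le> i \<and> (i - 2) mod 4 = 2 \<and> (i - 1) mod 4 = 3"
proof -
  define a where "a = i div 4"
  have i: "i = 4 * a + i mod 4" by (simp add: a_def)
  show "2 \<le> i \<and> (i - 2) mod 4 = 0 \<and> (i - 1) mod 4 = 1" if "i mod 4 = 2"
    using i unfolding that by (simp add: mod_Suc)
  show "3 \<le> i \<and> (i - 2) mod 4 = 1 \<and> (i - 1) mod 4 = 2" if "i mod 4 = 3"
    using i unfolding that by (simp add: mod_Suc)
  show "3 \<le> i \<and> (i - 2) mod 4 = 2 \<and> (i - 1) mod 4 = 3" if "i mod 4 = 0" "0 < i"
  proof -
    have "i = 4 * a" using i unfolding that(1) by simp
    moreover from this obtain b where "a = Suc b" using \<open>0 < i\<close> by (cases a) auto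
    ultimately have "i = 4 * b + 4" by simp
    then show ?thesis by (simp add: mod_Suc)
  qed
qed

lemma mod_4_Suc:
  fixes i :: nat
  shows "i mod 4 = 0 \<Longrightarrow> Suc i mod 4 = 1 \<and> (i + 2) mod 4 = 2"
    and "i mod 4 = 1 \<Longrightarrow> Suc i mod 4 = 2 \<and> (i + 2) mod 4 = 3"
    and "i mod 4 = 3 \<Longrightarrow> Suc i mod 4 = 0 \<and> (i + 2) mod 4 = 1"
  by (simp_all add: mod_Suc)

lemma mod_4_le:
  fixes i k :: nat
  assumes "4 dvd k" "i \<le> k"
  shows "i mod 4 = 3 \<Longrightarrow> Suc i \<le> k" "i mod 4 = 1 \<Longrightarrow> i + 2 \<le> k"
    and "i mod 4 = 0 \<Longrightarrow> i \<noteq> k \<Longrightarrow> i + 2 \<le> k"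
proof -
  define a where "a = i div 4"
  have i: "i = 4 * a + i mod 4" by (simp add: a_def)
  obtain n where n: "k = 4 * n" using assms(1) by (auto elim: dvdE)
  show "Suc i \<le> k" if "i mod 4 = 3"
    using i assms(2) unfolding n that by presburger
  show "i + 2 \<le> k" if "i mod 4 = 1"
    using i assms(2) unfolding n that by presburger
  show "i + 2 \<le> k" if "i mod 4 = 0" "i \<noteq> k"
    using i assms(2) that(2) unfolding n that(1) by presburger
qed

section \<open>Rigidity of the patterns on one subdivided edge\<close>

text \<open>The trace of a private set of the subdivision on a subdivided edge: a member at an
  inner position has a private neighbour one step to its left or one step to its right; nothing
  is known about the further neighbours of an end of the path.\<close>

definition private_pattern :: "nat \<Rightarrow> (nat \<Rightarrow> bool) \<Rightarrow> bool" where
  "private_pattern k x \<longleftrightarrow> (\<forall>i<k. x (Suc i) \<longrightarrow>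
     \<not> x i \<and> (0 < i \<longrightarrow> \<not> x (i - 1)) \<or>
     \<not> x (i + 2) \<and> (i + 2 \<le> k \<longrightarrow> \<not> x (i + 3)))"

lemma private_patternD:
  assumes "private_pattern k x" "i < k" "x (Suc i)"
  shows "\<not> x i \<and> (0 < i \<longrightarrow> \<not> x (i - 1)) \<or> \<not> x (i + 2) \<and> (i + 2 \<le> k \<longrightarrow> \<not> x (i + 3))"
  using assms by (auto simp: private_pattern_def)

lemma private_pattern_window_le:
  assumes "private_pattern k x" "s + 4 * q \<le> k"
  shows "card {i \<in> {s<..s + 4 * q}. x i} \<le> 2 * q"
proof (rule card_window_le)
  fix i assume "s < i" "i + 3 \<le> s + 4 * q + 1" "x (Suc i)"
  then show "\<not> x i \<and> (s + 1 < i \<longrightarrow> \<not> x (i - 1)) \<or>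
      \<not> x (i + 2) \<and> (i + 3 \<le> s + 4 * q \<longrightarrow> \<not> x (i + 3))"
    using private_patternD[OF assms(1), of i] assms(2) by auto
qed

text \<open>The bounds 2 for the first block and \<open>2 * q\<close> for the rest add up to the
  assumed total, so both are attained.\<close>

lemma full_private_pattern_blocks:
  assumes "private_pattern k x" "s + 4 * Suc q \<le> k"
    and "card {i \<in> {s<..s + 4 * Suc q}. x i} = 2 * Suc q"
  shows "of_bool (x (s + 1)) + of_bool (x (s + 2)) + of_bool (x (s + 3))
      + of_bool (x (s + 4)) = (2 :: nat)"
    and "card {i \<in> {s + 4<..s + 4 + 4 * q}. x i} = 2 * q"
proof -
  have "card {i \<in> {s + 4<..s + 4 + 4 * q}. x i} \<le> 2 * q"
    using assms by (intro private_pattern_window_le) auto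
  moreover have "card {i \<in> {s<..s + 4 * 1}. x i} \<le> 2 * 1"
    using assms by (intro private_pattern_window_le) auto
  then have "of_bool (x (s + 1)) + of_bool (x (s + 2)) + of_bool (x (s + 3))
      + of_bool (x (s + 4)) \<le> (2 :: nat)"
    using card_block_Suc[of s 0 x] by simp
  moreover have tight: "a = 2 \<and> c = 2 * q" if "c \<le> 2 * q" "a \<le> 2" "a + c = 2 * Suc q" for a c
    using that by auto
  ultimately have "of_bool (x (s + 1)) + of_bool (x (s + 2)) + of_bool (x (s + 3))
      + of_bool (x (s + 4)) = (2 :: nat) \<and> card {i \<in> {s + 4<..s + 4 + 4 * q}. x i} = 2 * q"
    using assms(3) tight unfolding card_block_Suc by blast
  then show "of_bool (x (s + 1)) + of_bool (x (s + 2)) + of_bool (x (s + 3))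
      + of_bool (x (s + 4)) = (2 :: nat)"
    and "card {i \<in> {s + 4<..s + 4 + 4 * q}. x i} = 2 * q"
    by blast+
qed

text \<open>A block that begins 00 and holds two selected positions is 0011. Its last position has a
  selected left neighbour, so its private neighbour is on the right and the next block begins 00
  again.\<close>

lemma full_private_pattern_0011:
  assumes "private_pattern k x" "s + 4 * Suc q = k"
    and "card {i \<in> {s<..s + 4 * Suc q}. x i} = 2 * Suc q" "\<not> x (s + 1)" "\<not> x (s + 2)"
  shows "x (k - 1) \<and> x k"
  using assms(2-)
proof (induction q arbitrary: s)
  case 0
  have "x (s + 3)" "x (s + 4)"
    using full_private_pattern_blocks(1)[OF assms(1), of s 0] 0 by (auto simp: of_bool_def split: if_splits)
  moreover have "k - 1 = s + 3" "k = s + 4" using 0 by auto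
  ultimately show ?case by metis
next
  case (Suc q)
  have b: "x (s + 3)" "x (s + 4)"
    using full_private_pattern_blocks(1)[OF assms(1), of s "Suc q"] Suc.prems
    by (auto simp: of_bool_def split: if_splits)
  have "\<not> x (s + 3 + 2)" "\<not> x (s + 3 + 3)"
    using private_patternD[OF assms(1), of "s + 3"] b Suc.prems by (auto simp: add.commute)
  then show ?case
    using full_private_pattern_blocks(2)[OF assms(1), of s "Suc q"] Suc.prems
    by (intro Suc.IH[of "s + 4"]) (auto simp: add.commute)
qed

text \<open>If \<open>x s\<close> holds, at most one of the next three positions is selected, so the
  second selected position of the block is \<open>s + 4\<close>, and the argument repeats. With
  \<open>s = 0\<close> the initial position is an old vertex.\<close>

lemma full_private_pattern_1001:
  assumes "private_pattern k x" "s + 4 * q = k"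
    and "card {i \<in> {s<..s + 4 * q}. x i} = 2 * q" "x s"
  shows "x k"
  using assms(2-)
proof (induction q arbitrary: s)
  case (Suc q)
  have b: "of_bool (x (s + 1)) + of_bool (x (s + 2)) + of_bool (x (s + 3))
      + of_bool (x (s + 4)) = (2 :: nat)"
    using full_private_pattern_blocks(1)[OF assms(1), of s q] Suc.prems by simp
  have c: "x (s + 1) \<Longrightarrow> \<not> x (s + 2) \<and> \<not> x (s + 3)" "x (s + 2) \<Longrightarrow> \<not> x (s + 3)"
    using private_patternD[OF assms(1), of s] private_patternD[OF assms(1), of "s + 1"] Suc.prems
    by (auto simp: numeral_eq_Suc)
  have "x (s + 4)"
    using b c by (auto simp: of_bool_def numeral_eq_Suc split: if_splits)
  then show ?case
    using full_private_pattern_blocks(2)[OF assms(1), of s q] Suc.prems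
    by (intro Suc.IH[of "s + 4"]) auto
qed simp

section \<open>Complements of super dominating sets\<close>

definition private_set :: "'a graph \<Rightarrow> 'a set \<Rightarrow> bool" where
  "private_set G X \<longleftrightarrow>
     X \<subseteq> verts G \<and> (\<forall>x \<in> X. \<exists>y \<in> verts G - X. nbhd G y \<inter> X = {x})"

text \<open>For the converse, a vertex outside \<open>D\<close> is dominated by its own private
  neighbour, because adjacency is symmetric.\<close>

lemma super_dominating_set_iff_private_set:
  assumes "D \<subseteq> verts G"
  shows "super_dominating_set G D \<longleftrightarrow> private_set G (verts G - D)"
proof -
  have "dominating_set G D" if "private_set G (verts G - D)"
    unfolding dominating_set_def
  proof (intro conjI ballI)
    fix x assume "x \<in> verts G - D"
    then obtain y where y: "y \<in> verts G - (verts G - D)" "nbhd G y \<inter> (verts G - D) = {x}"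
      using \<open>private_set G (verts G - D)\<close> by (auto simp: private_set_def)
    then have "x \<in> nbhd G y" by blast
    then have "y \<in> nbhd G x" using y(1) by (simp add: nbhd_def insert_commute)
    then show "nbhd G x \<inter> D \<noteq> {}" using y(1) by blast
  qed fact
  moreover have "verts G - (verts G - D) = D" using assms by blast
  ultimately show ?thesis
    unfolding super_dominating_set_def private_set_def by auto
qed

text \<open>With the next lemma, this identifies the super domination number with the number of
  vertices minus the largest size of a private set. Sums avoid truncated subtraction.\<close>

lemma super_domination_number_le:
  assumes "finite_simple_graph G" "private_set G X"
  shows "super_domination_number G + card X \<le> card (verts G)"
proof -
  have fin: "finite (verts G)" and sub: "X \<subseteq> verts G"
    using assms by (auto simp: finite_simple_graph_def private_set_def)
  have "verts G - (verts G - X) = X" using sub by blast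
  then have "super_dominating_set G (verts G - X)"
    using assms super_dominating_set_iff_private_set[of "verts G - X" G] by auto
  moreover have "{D. super_dominating_set G D} \<subseteq> Pow (verts G)"
    by (auto simp: super_dominating_set_def dominating_set_def)
  then have "finite {D. super_dominating_set G D}"
    using fin finite_subset by auto
  ultimately have "super_domination_number G \<le> card (verts G - X)"
    unfolding super_domination_number_def by (intro Min_le) auto
  then show ?thesis
    using fin sub card_mono[OF fin sub] by (simp add: card_Diff_subset finite_subset)
qed

lemma super_domination_number_private_set:
  assumes "finite_simple_graph G"
  obtains X where "private_set G X" "super_domination_number G + card X = card (verts G)"
proof -
  obtain D where D: "super_dominating_set G D" "card D = super_domination_number G"
    using super_domination_number_attained[OF assms] .
  then have sub: "D \<subseteq> verts G"
    by (auto simp: super_dominating_set_def dominating_set_def)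
  have fin: "finite (verts G)" using assms by (simp add: finite_simple_graph_def)
  have "card D + card (verts G - D) = card (verts G)"
    using fin sub card_mono[OF fin sub] by (simp add: card_Diff_subset finite_subset)
  then show thesis
    using that[of "verts G - D"] D super_dominating_set_iff_private_set[OF sub] by simp
qed

section \<open>Vertices, edges and neighbourhoods of the subdivision\<close>

locale subdivided_graph =
  fixes G :: "'a graph" and k :: nat
  assumes finite_simple: "finite_simple_graph G"
begin

abbreviation "H \<equiv> subdivision k G"
abbreviation "P \<equiv> path_vertex k"

text \<open>Indexed by the unordered edge, so that a sum over \<open>edges G\<close> counts each
  path once.\<close>

definition inner :: "'a set \<Rightarrow> 'a subdiv_vertex set" where
  "inner e = {P u v i | u v i. {u, v} = e \<and> 1 \<le> i \<and> i \<le> k}"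

lemma edgeD:
  assumes "{u, v} \<in> edges G"
  shows "u \<in> verts G" "v \<in> verts G" "u \<noteq> v" "{v, u} \<in> edges G"
proof -
  have "{u, v} \<subseteq> verts G \<and> card {u, v} = 2"
    using finite_simple assms unfolding finite_simple_graph_def by blast
  then show "u \<in> verts G" "v \<in> verts G" "u \<noteq> v" by auto
  show "{v, u} \<in> edges G" using assms by (simp only: insert_commute)
qed

lemma edgeE:
  assumes "e \<in> edges G"
  obtains u v where "e = {u, v}" "u \<noteq> v"
  using finite_simple assms by (auto simp: finite_simple_graph_def card_2_iff)

lemma finite_verts: "finite (verts G)"
  using finite_simple by (simp add: finite_simple_graph_def)

lemma finite_edges: "finite (edges G)"
  using finite_simple finite_subset[of "edges G" "Pow (verts G)"]
  by (auto simp: finite_simple_graph_def)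

lemma P_ends [simp]: "P u v 0 = Old u" "P u v (Suc k) = Old v"
  by (auto simp: path_vertex_def)

lemma P_eq_Old: "i \<le> Suc k \<Longrightarrow> P u v i = Old w \<longleftrightarrow> i = 0 \<and> w = u \<or> i = Suc k \<and> w = v"
  by (auto simp: path_vertex_def)

lemma inner_pair:
  "inner {u, v} = P u v ` {0<..k}"
proof -
  have "P v u i \<in> P u v ` {0<..k}" if "1 \<le> i" "i \<le> k" for i
    using path_vertex_reverse[of i k u v] that by (intro image_eqI[of _ _ "k + 1 - i"]) auto
  then have "inner {u, v} \<subseteq> P u v ` {0<..k}"
    by (auto simp: inner_def doubleton_eq_iff)
  moreover have "P u v ` {0<..k} \<subseteq> inner {u, v}"
    unfolding inner_def by (auto simp: Suc_le_eq) blast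
  ultimately show ?thesis ..
qed

lemma P_inject:
  assumes "u \<noteq> v" "i \<le> Suc k" "j \<le> Suc k"
  shows "P u v i = P u v j \<longleftrightarrow> i = j"
  using assms by (auto simp: path_vertex_def doubleton_eq_iff)

lemma Old_notin_inner [simp]: "Old u \<notin> inner e"
  by (auto simp: inner_def path_vertex_def)

lemma verts_H: "verts H = Old ` verts G \<union> (\<Union>e\<in>edges G. inner e)"
  by (auto simp: subdivision_def inner_def)

lemma P_in_verts:
  assumes "{u, v} \<in> edges G" "i \<le> Suc k"
  shows "P u v i \<in> verts H"
proof (cases "i = 0 \<or> i = Suc k")
  case True
  then show ?thesis using edgeD[OF assms(1)] by (auto simp: verts_H)
next
  case False
  then show ?thesis using assms by (auto simp: verts_H inner_pair intro!: UnI2 bexI[of _ "{u, v}"])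
qed

lemma inner_disjoint:
  assumes "e \<in> edges G" "e' \<in> edges G" "e \<noteq> e'"
  shows "inner e \<inter> inner e' = {}"
proof (rule ccontr)
  assume "inner e \<inter> inner e' \<noteq> {}"
  then obtain u v i a b j where "{u, v} = e" "1 \<le> i" "i \<le> k" "{a, b} = e'" "1 \<le> j" "j \<le> k"
    "P u v i = P a b j"
    unfolding inner_def by blast
  moreover from this have "u \<noteq> v" "a \<noteq> b" using assms edgeD(3) by blast+
  ultimately show False
    using assms(3) path_vertex_inject[of u v a b i k j] by (auto simp: doubleton_eq_iff)
qed

lemma finite_inner: "e \<in> edges G \<Longrightarrow> finite (inner e)"
  by (auto elim!: edgeE simp: inner_pair)

lemma card_Int_inner:
  assumes "u \<noteq> v"
  shows "card (X \<inter> inner {u, v}) = card {i \<in> {0<..k}. P u v i \<in> X}"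
proof -
  have "X \<inter> inner {u, v} = P u v ` {i \<in> {0<..k}. P u v i \<in> X}"
    by (auto simp: inner_pair)
  moreover have "inj_on (P u v) {i \<in> {0<..k}. P u v i \<in> X}"
    using assms by (auto simp: inj_on_def P_inject)
  ultimately show ?thesis by (simp add: card_image)
qed

text \<open>The old vertices and the sets \<open>inner e\<close> partition the vertices of
  \<open>H\<close>. Both inequalities of the theorem are counted edge by edge in this way.\<close>

lemma card_subset_verts_H:
  assumes "X \<subseteq> verts H"
  shows "card X = card {u. Old u \<in> X} + (\<Sum>e\<in>edges G. card (X \<inter> inner e))"
proof -
  have "{u. Old u \<in> X} \<subseteq> verts G" using assms by (auto simp: verts_H)
  then have fin: "finite {u. Old u \<in> X}" using finite_verts finite_subset by blast
  have X: "X = Old ` {u. Old u \<in> X} \<union> (\<Union>e\<in>edges G. X \<inter> inner e)"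
    using assms by (auto simp: verts_H)
  have "card X = card (Old ` {u. Old u \<in> X}) + card (\<Union>e\<in>edges G. X \<inter> inner e)"
    by (subst X, rule card_Un_disjoint) (auto simp: fin finite_edges finite_inner)
  also have "card (\<Union>e\<in>edges G. X \<inter> inner e) = (\<Sum>e\<in>edges G. card (X \<inter> inner e))"
    using inner_disjoint by (intro card_UN_disjoint) (auto simp: finite_edges finite_inner)
  also have "card (Old ` {u. Old u \<in> X}) = card {u. Old u \<in> X}"
    by (simp add: card_image inj_on_def)
  finally show ?thesis .
qed

lemma card_verts_H: "card (verts H) = card (verts G) + k * card (edges G)"
proof -
  have "card (verts H \<inter> inner e) = k" if e: "e \<in> edges G" for e
  proof -
    obtain u v where uv: "e = {u, v}" "u \<noteq> v" using edgeE[OF e] .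
    then have "{i \<in> {0<..k}. P u v i \<in> verts H} = {0<..k}"
      using P_in_verts e by auto
    then show ?thesis using uv by (simp add: card_Int_inner)
  qed
  moreover have "{u. Old u \<in> verts H} = verts G" by (auto simp: verts_H)
  ultimately show ?thesis by (simp add: card_subset_verts_H[of "verts H"])
qed

text \<open>Reading the path from its other end if necessary makes \<open>x\<close> the earlier of
  the two vertices.\<close>

lemma edges_H_iff:
  "{x, w} \<in> edges H \<longleftrightarrow>
    (\<exists>u v i. {u, v} \<in> edges G \<and> i \<le> k \<and> x = P u v i \<and> w = P u v (Suc i))"
proof
  assume "{x, w} \<in> edges H"
  then obtain u v i where i: "{u, v} \<in> edges G" "i \<le> k" "{x, w} = {P u v i, P u v (Suc i)}"
    by (auto simp: subdivision_def)
  then consider "x = P u v i" "w = P u v (Suc i)" | "w = P u v i" "x = P u v (Suc i)"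
    by (auto simp: doubleton_eq_iff)
  then show "\<exists>u v i. {u, v} \<in> edges G \<and> i \<le> k \<and> x = P u v i \<and> w = P u v (Suc i)"
  proof cases
    case 1
    then show ?thesis using i by blast
  next
    case 2
    have "x = P v u (k - i)" "w = P v u (Suc (k - i))"
      using 2 i path_vertex_reverse[of i k v u] path_vertex_reverse[of "Suc i" k v u]
      by (auto simp: Suc_diff_le)
    then show ?thesis using edgeD(4)[OF i(1)] i(2) by (metis diff_le_self)
  qed
qed (auto simp: subdivision_def)

lemma nbhd_sym: "w \<in> nbhd H x \<Longrightarrow> x \<in> verts H \<Longrightarrow> x \<in> nbhd H w"
  by (simp add: nbhd_def insert_commute)

lemma nbhd_Old:
  assumes "0 < k"
  shows "nbhd H (Old u) = {P u v 1 | v. {u, v} \<in> edges G}"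
proof -
  have "{Old u, w} \<in> edges H \<longleftrightarrow> (\<exists>v. {u, v} \<in> edges G \<and> w = P u v 1)" for w
    unfolding edges_H_iff
  proof (intro iffI; elim exE conjE)
    fix a b i assume "{a, b} \<in> edges G" "i \<le> k" "Old u = P a b i" "w = P a b (Suc i)"
    then show "\<exists>v. {u, v} \<in> edges G \<and> w = P u v 1"
      using P_eq_Old[of i a b u] by auto
  next
    fix v assume "{u, v} \<in> edges G" "w = P u v 1"
    then show "\<exists>a b i. {a, b} \<in> edges G \<and> i \<le> k \<and> Old u = P a b i \<and> w = P a b (Suc i)"
      by (intro exI[of _ u] exI[of _ v] exI[of _ 0]) auto
  qed
  then show ?thesis
    using P_in_verts assms by (auto simp: nbhd_def)
qed

lemma nbhd_inner:
  assumes uv: "{u, v} \<in> edges G" and i: "i < k"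
  shows "nbhd H (P u v (Suc i)) = {P u v i, P u v (i + 2)}"
proof -
  have "w = P u v i \<or> w = P u v (i + 2)" if "{P u v (Suc i), w} \<in> edges H" for w
  proof -
    from that obtain a b j where ab: "{a, b} \<in> edges G" "j \<le> k" "P u v (Suc i) = P a b j"
      "w = P a b (Suc j)"
      unfolding edges_H_iff by blast
    have "j \<noteq> 0" using ab(3) P_eq_Old[of "Suc i" u v a] i by (cases j) auto
    then have "u = a \<and> v = b \<and> Suc i = j \<or> u = b \<and> v = a \<and> j = k + 1 - Suc i"
      using path_vertex_inject[of u v a b "Suc i" k j] ab edgeD[OF uv] edgeD[OF ab(1)] i by auto
    moreover have "P v u (Suc (k - i)) = P u v i"
      using path_vertex_reverse[of i k v u] i by (simp add: Suc_diff_le)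
    ultimately show ?thesis using ab(4) i by auto
  qed
  moreover have "{P u v (Suc i), P u v (i + 2)} \<in> edges H"
    unfolding edges_H_iff using uv i by (intro exI[of _ u] exI[of _ v] exI[of _ "Suc i"]) auto
  moreover have "{P u v i, P u v (Suc i)} \<in> edges H"
    unfolding edges_H_iff using uv i by (intro exI[of _ u] exI[of _ v] exI[of _ i]) auto
  ultimately show ?thesis
    using P_in_verts[OF uv, of i] P_in_verts[OF uv, of "i + 2"] i
    unfolding nbhd_def insert_commute[of "P u v i" "P u v (Suc i)"] by auto
qed

section \<open>Extending a private set to the subdivision\<close>

lemma private_set_subdivision:
  assumes k: "4 dvd k" "0 < k" and X: "private_set G X"
  obtains X' where "private_set H X'" "card X' = card X + k div 2 * card (edges G)"
proof -
  have subX: "X \<subseteq> verts G" using X by (simp add: private_set_def)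
  have "\<forall>x. \<exists>y. x \<in> X \<longrightarrow> y \<in> verts G - X \<and> nbhd G y \<inter> X = {x}"
    using X by (auto simp: private_set_def)
  then obtain f where f: "\<And>x. x \<in> X \<Longrightarrow> f x \<in> verts G - X \<and> nbhd G (f x) \<inter> X = {x}"
    by metis
  \<comment> \<open>Every case has two residues, which gives \<open>k div 2\<close> inner vertices
    per edge.\<close>
  define S :: "'a \<Rightarrow> 'a \<Rightarrow> nat set" where "S = (\<lambda>u v.
    if u \<notin> X \<and> v \<notin> X then {2, 3}
    else if u \<in> X \<and> f u = v then {3, 0}
    else if v \<in> X \<and> f v = u then {1, 2}
    else {0, 1})"
  \<comment> \<open>The ends \<open>0\<close> and \<open>Suc k\<close> follow \<open>X\<close>,
    whatever their residues.\<close>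
  define q where "q = (\<lambda>u v i. if i = 0 then u \<in> X else if i = Suc k then v \<in> X else i mod 4 \<in> S u v)"
  define X' where "X' = {P u v i | u v i. {u, v} \<in> edges G \<and> i \<le> Suc k \<and> q u v i} \<union> Old ` X"
  \<comment> \<open>An inner vertex has a name from each end of its path, and selection must not
    depend on the name. As 4 divides \<open>k\<close>, the positions \<open>i\<close> and
    \<open>Suc k - i\<close> have residues adding up to 1 modulo 4, so reversal swaps 0 with 1 and 2
    with 3, just as \<open>S u v\<close> turns into \<open>S v u\<close>.\<close>
  have q_rev: "q v u (Suc k - i) = q u v i" if "i \<le> Suc k" for u v i
  proof -
    have "(Suc k - i) mod 4 \<in> S v u \<longleftrightarrow> i mod 4 \<in> S u v"
    proof -
      have m: "i mod 4 = 0 \<and> (Suc k - i) mod 4 = 1 \<or> i mod 4 = 1 \<and> (Suc k - i) mod 4 = 0 \<or>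
          i mod 4 = 2 \<and> (Suc k - i) mod 4 = 3 \<or> i mod 4 = 3 \<and> (Suc k - i) mod 4 = 2"
      proof -
        have "(i mod 4 + (Suc k - i) mod 4) mod 4 = Suc k mod 4"
          using that by (simp add: mod_add_eq)
        also have "Suc k mod 4 = 1" using k(1) by (auto elim!: dvdE)
        finally have "(i mod 4 + (Suc k - i) mod 4) mod 4 = 1" .
        moreover have "i mod 4 \<in> {0, 1, 2, 3}" "(Suc k - i) mod 4 \<in> {0, 1, 2, 3}" by auto
        ultimately show ?thesis by auto
      qed
      have "u \<in> X \<Longrightarrow> f u \<notin> X" "v \<in> X \<Longrightarrow> f v \<notin> X" using f by auto
      then have "S u v = {2, 3} \<and> S v u = {2, 3} \<or> S u v = {3, 0} \<and> S v u = {1, 2} \<or>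
          S u v = {1, 2} \<and> S v u = {3, 0} \<or> S u v = {0, 1} \<and> S v u = {0, 1}"
        by (cases "u \<in> X"; cases "v \<in> X"; cases "f u = v"; cases "f v = u")
          (simp_all add: S_def)
      then show ?thesis using m by (elim disjE conjE) simp_all
    qed
    then show ?thesis using that by (auto simp: q_def)
  qed
  have Old_X': "Old u \<in> X' \<longleftrightarrow> u \<in> X" for u
  proof
    assume "Old u \<in> X'"
    then consider "u \<in> X" | a b j where "P a b j = Old u" "j \<le> Suc k" "q a b j"
      unfolding X'_def by auto
    then show "u \<in> X"
    proof cases
      case 2
      then show ?thesis using P_eq_Old[of j a b u] by (auto simp: q_def split: if_splits)
    qed
  qed (simp add: X'_def)
  have P_X': "P u v i \<in> X' \<longleftrightarrow> q u v i" if uv: "{u, v} \<in> edges G" and i: "i \<le> Suc k" for u v i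
  proof (cases "i = 0 \<or> i = Suc k")
    case True
    then show ?thesis using Old_X' by (auto simp: q_def)
  next
    case False
    show ?thesis
    proof
      assume "P u v i \<in> X'"
      moreover have no: "P u v i \<noteq> Old w" for w using P_eq_Old[OF i] False by simp
      ultimately obtain a b j where abj: "P u v i = P a b j" "{a, b} \<in> edges G" "j \<le> Suc k" "q a b j"
        unfolding X'_def by auto
      then have "P a b j \<noteq> Old w" for w using no by metis
      then have "j \<noteq> 0" "j \<noteq> Suc k" using P_ends by metis+
      then have "u = a \<and> v = b \<and> i = j \<or> u = b \<and> v = a \<and> j = k + 1 - i"
        using path_vertex_inject[of u v a b i k j] edgeD(3)[OF uv] edgeD(3)[OF abj(2)] abj False i
        by simp
      then show "q u v i" using abj(4) q_rev[OF i, of v u] by auto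
    next
      assume "q u v i"
      then show "P u v i \<in> X'" using uv i unfolding X'_def by blast
    qed
  qed
  have right: "\<exists>y \<in> verts H - X'. nbhd H y \<inter> X' = {P u v i}"
    if "{u, v} \<in> edges G" "Suc i \<le> k" "q u v i" "\<not> q u v (Suc i)" "\<not> q u v (i + 2)" for u v i
    using that P_in_verts[of u v "Suc i"] nbhd_inner[of u v i]
    by (intro bexI[of _ "P u v (Suc i)"]) (auto simp: P_X')
  have "\<exists>y \<in> verts H - X'. nbhd H y \<inter> X' = {P u v (i + 2)}"
    if "{u, v} \<in> edges G" "Suc i \<le> k" "\<not> q u v i" "\<not> q u v (Suc i)" "q u v (i + 2)" for u v i
    using that P_in_verts[of u v "Suc i"] nbhd_inner[of u v i]
    by (intro bexI[of _ "P u v (Suc i)"]) (auto simp: P_X')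
  then have left: "\<exists>y \<in> verts H - X'. nbhd H y \<inter> X' = {P u v i}"
    if "{u, v} \<in> edges G" "2 \<le> i" "i \<le> Suc k" "\<not> q u v (i - 2)" "\<not> q u v (i - 1)" "q u v i" for u v i
    using that(1,3-) le_Suc_ex[OF that(2)] by (auto simp: add.commute)
  have k4: "4 \<le> k" using k by (auto elim!: dvdE)
  \<comment> \<open>Here the private neighbour is the old vertex \<open>v\<close>. On the path to
    \<open>u\<close> the residues seen from \<open>v\<close> are 1, 2, so the first vertex is
    selected. Any other neighbour of \<open>v\<close> is outside \<open>X\<close>, so its path has
    residues 2, 3 and its first vertex is not selected.\<close>
  have last: "\<exists>y \<in> verts H - X'. nbhd H y \<inter> X' = {P u v k}" if u: "u \<in> X" "f u = v" for u v
  proof (intro bexI[of _ "Old v"])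
    have v: "v \<in> verts G" "v \<notin> X" "nbhd G v \<inter> X = {u}" using f u by auto
    then show "Old v \<in> verts H - X'" by (simp add: verts_H Old_X')
    have vu: "{v, u} \<in> edges G" using v(3) by (auto simp: nbhd_def)
    have uk: "P v u 1 = P u v k" using path_vertex_reverse[of k k v u] by simp
    have "q v w 1 \<longleftrightarrow> w = u" if "{v, w} \<in> edges G" for w
    proof (cases "w = u")
      case True
      then show ?thesis using u v k4 by (auto simp: q_def S_def)
    next
      case False
      then have "w \<notin> X" using v(3) that edgeD[OF that] by (auto simp: nbhd_def)
      then show ?thesis using False v k4 by (simp add: q_def S_def)
    qed
    then have "P v w 1 \<in> X' \<longleftrightarrow> w = u" if "{v, w} \<in> edges G" for w
      using that P_X'[of v w 1] by simp
    then show "nbhd H (Old v) \<inter> X' = {P u v k}"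
      unfolding nbhd_Old[OF k(2)] uk[symmetric] using vu by auto
  qed
  \<comment> \<open>The excluded case \<open>f v = u\<close> is the reverse of
    \<open>f u = v\<close> and is recovered in \<open>inner_private\<close>.\<close>
  have half: "\<exists>y \<in> verts H - X'. nbhd H y \<inter> X' = {P u v i}"
    if uv: "{u, v} \<in> edges G" and i: "1 \<le> i" "i \<le> k" and q: "q u v i"
      and nf: "\<not> (v \<in> X \<and> f v = u)" for u v i
  proof -
    have qS: "q u v j \<longleftrightarrow> j mod 4 \<in> S u v" if "1 \<le> j" "j \<le> k" for j
      using that by (auto simp: q_def)
    then have iS: "i mod 4 \<in> S u v" using q i by simp
    consider "u \<notin> X" "v \<notin> X" | "u \<in> X" "f u = v" | "u \<in> X \<or> v \<in> X" "\<not> (u \<in> X \<and> f u = v)"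
      by blast
    then show ?thesis
    proof cases
      case 1
      then have S: "S u v = {2, 3}" by (simp add: S_def)
      then consider "i mod 4 = 2" | "i mod 4 = 3" using iS by auto
      then show ?thesis
      proof cases
        \<comment> \<open>Two steps from \<open>i = 2\<close> to the left, or from
          \<open>i = k - 1\<close> to the right, lead to an end of the path; neither end is in
          \<open>X\<close>.\<close>
        case a: 1
        then have "2 \<le> i" "(i - 2) mod 4 = 0" "(i - 1) mod 4 = 1" using mod_4_pred by auto
        then show ?thesis using uv i q 1 S by (intro left) (auto simp: q_def)
      next
        case a: 2
        then have "Suc i \<le> k" "Suc i mod 4 = 0" "(i + 2) mod 4 = 1"
          using mod_4_Suc[of i] mod_4_le[OF k(1) i(2)] by auto
        then show ?thesis using uv i q 1 S by (intro right) (auto simp: q_def)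
      qed
    next
      case 2
      then have S: "S u v = {3, 0}" by (simp add: S_def)
      then consider "i mod 4 = 3" | "i = k" | "i mod 4 = 0" "i \<noteq> k" using iS S by (cases "i = k") auto
      then show ?thesis
      proof cases
        case a: 1
        then have "3 \<le> i" "(i - 2) mod 4 = 1" "(i - 1) mod 4 = 2" using mod_4_pred by auto
        then show ?thesis using uv i q S by (intro left) (auto simp: q_def)
      next
        case a: 2
        then show ?thesis using last 2 by simp
      next
        case a: 3
        then have "i + 2 \<le> k" "Suc i mod 4 = 1" "(i + 2) mod 4 = 2"
          using mod_4_Suc[of i] mod_4_le[OF k(1) i(2)] by auto
        then show ?thesis using uv i q S by (intro right) (auto simp: q_def)
      qed
    next
      \<comment> \<open>In the pattern 1001...1001 the two positions inspected beside
        \<open>i\<close> are always inner, so the ends may be selected or not.\<close>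
      case 3
      then have S: "S u v = {0, 1}" using nf by (auto simp: S_def)
      have "i mod 4 = 0 \<or> i mod 4 = 1" using iS by (simp only: S insert_iff empty_iff simp_thms)
      then consider "i mod 4 = 0" | "i mod 4 = 1" by (elim disjE)
      then show ?thesis
      proof cases
        case a: 1
        then have "3 \<le> i" "(i - 2) mod 4 = 2" "(i - 1) mod 4 = 3"
          using mod_4_pred(3)[of i] i(1) by auto
        moreover from this have "\<not> q u v (i - 2)" "\<not> q u v (i - 1)"
          using i by (subst qS; (simp only: S)?; simp)+
        ultimately show ?thesis using uv i q by (intro left) simp_all
      next
        case a: 2
        then have "i + 2 \<le> k" "Suc i mod 4 = 2" "(i + 2) mod 4 = 3"
          using mod_4_Suc[of i] mod_4_le[OF k(1) i(2)] by auto
        moreover from this have "\<not> q u v (Suc i)" "\<not> q u v (i + 2)"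
          using i by (subst qS; (simp only: S)?; simp)+
        ultimately show ?thesis using uv i q by (intro right) simp_all
      qed
    qed
  qed
  have inner_private: "\<exists>y \<in> verts H - X'. nbhd H y \<inter> X' = {P u v i}"
    if uv: "{u, v} \<in> edges G" and i: "1 \<le> i" "i \<le> k" and q: "q u v i" for u v i
  proof (cases "v \<in> X \<and> f v = u")
    case True
    then have "\<not> (u \<in> X \<and> f u = v)" using f by auto
    then have "\<exists>y \<in> verts H - X'. nbhd H y \<inter> X' = {P v u (Suc k - i)}"
      using i q q_rev[of i v u] edgeD(4)[OF uv] by (intro half) auto
    then show ?thesis using path_vertex_reverse[of i k v u] i by simp
  qed (use that half in blast)
  have "private_set H X'"
    unfolding private_set_def
  proof (intro conjI ballI)
    have "Old ` X \<subseteq> verts H" using subX by (auto simp: verts_H)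
    then show "X' \<subseteq> verts H" using P_in_verts unfolding X'_def by blast
    fix x assume "x \<in> X'"
    then consider u where "x = Old u" "u \<in> X"
      | u v i where "x = P u v i" "{u, v} \<in> edges G" "1 \<le> i" "i \<le> k" "q u v i"
    proof -
      have thesis if "{u, v} \<in> edges G" "i \<le> Suc k" "q u v i" "x = P u v i"
        "\<And>u. x = Old u \<Longrightarrow> u \<in> X \<Longrightarrow> thesis"
        "\<And>u v i. x = P u v i \<Longrightarrow> {u, v} \<in> edges G \<Longrightarrow> 1 \<le> i \<Longrightarrow> i \<le> k \<Longrightarrow> q u v i \<Longrightarrow> thesis"
        for u v i thesis
      proof (cases "i = 0 \<or> i = Suc k")
        case True
        then show ?thesis using that(3-5) by (auto simp: q_def)
      next
        case False
        then show ?thesis using that(1-4) by (intro that(6)[of u v i]) auto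
      qed
      then show ?thesis using \<open>x \<in> X'\<close> that unfolding X'_def by blast
    qed
    then show "\<exists>y \<in> verts H - X'. nbhd H y \<inter> X' = {x}"
    proof cases
      case 1
      \<comment> \<open>The private neighbour of \<open>Old u\<close> is the first vertex on the
        path to \<open>f u\<close>, where the residues 1 and 2 are unselected.\<close>
      have uf: "{u, f u} \<in> edges G" using f[OF 1(2)] by (auto simp: nbhd_def insert_commute)
      have "S u (f u) = {3, 0}" using 1 by (simp add: S_def)
      then show ?thesis
        using right[OF uf, of 0] 1 k4 by (simp add: q_def)
    next
      case 2
      then show ?thesis using inner_private by simp
    qed
  qed
  moreover have "card X' = card X + k div 2 * card (edges G)"
  proof -
    have "card (X' \<inter> inner e) = k div 2" if e: "e \<in> edges G" for e
    proof -
      obtain u v where uv: "e = {u, v}" "u \<noteq> v" using edgeE[OF e] .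
      have "{i \<in> {0<..k}. P u v i \<in> X'} = {i \<in> {0<..4 * (k div 4)}. i mod 4 \<in> S u v}"
        using e uv k(1) by (auto simp: P_X' q_def)
      moreover have "card {i \<in> {0<..4 * (k div 4)}. i mod 4 \<in> S u v} = k div 4 * 2"
        unfolding card_periodic[of "k div 4" "\<lambda>r. r \<in> S u v"] by (simp add: S_def)
      moreover have "k div 4 * 2 = k div 2" using k(1) by (auto elim: dvdE)
      ultimately show ?thesis
        unfolding uv(1) card_Int_inner[OF uv(2)] by simp
    qed
    moreover have "{u. Old u \<in> X'} = X" by (simp add: Old_X')
    ultimately show ?thesis
      using \<open>private_set H X'\<close> by (simp add: private_set_def card_subset_verts_H)
  qed
  ultimately show thesis by (rule that)
qed

section \<open>Projecting a private set of the subdivision to the graph\<close>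

lemma private_pattern_path:
  assumes X: "private_set H X" and uv: "{u, v} \<in> edges G"
  shows "private_pattern k (\<lambda>i. P u v i \<in> X)"
  unfolding private_pattern_def
proof (intro allI impI)
  fix i assume i: "i < k" and Xi: "P u v (Suc i) \<in> X"
  have neq: "u \<noteq> v" using edgeD[OF uv] by simp
  obtain y where y: "y \<in> verts H - X" "nbhd H y \<inter> X = {P u v (Suc i)}"
    using X Xi by (auto simp: private_set_def)
  then have "y \<in> nbhd H (P u v (Suc i))"
    using nbhd_sym[of "P u v (Suc i)" y] by blast
  \<comment> \<open>An inner vertex has only its two path neighbours, so its private neighbour is
    one of them. If that one is inner as well, its other path neighbour is outside
    \<open>X\<close>.\<close>
  then consider "y = P u v i" | "y = P u v (i + 2)"
    using nbhd_inner[OF uv i] by blast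
  then show "P u v i \<notin> X \<and> (0 < i \<longrightarrow> P u v (i - 1) \<notin> X) \<or>
      P u v (i + 2) \<notin> X \<and> (i + 2 \<le> k \<longrightarrow> P u v (i + 3) \<notin> X)"
  proof cases
    case 1
    have "P u v (i - 1) \<notin> X" if "0 < i"
      using nbhd_inner[OF uv, of "i - 1"] y(2) 1 that i neq P_inject[of u v "i - 1" "Suc i"] by auto
    then show ?thesis using 1 y by auto
  next
    case 2
    have "P u v (i + 3) \<notin> X" if "i + 2 \<le> k"
      using nbhd_inner[OF uv, of "Suc i"] y(2) 2 that i neq P_inject[of u v "i + 3" "Suc i"]
      by (auto simp: numeral_eq_Suc)
    then show ?thesis using 2 y by auto
  qed
qed

text \<open>All neighbours of an old vertex are first inner vertices of paths; the private one
  singles out the edge later recorded by \<open>h\<close>.\<close>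

lemma private_neighbour_Old:
  assumes X: "private_set H X" and u: "Old u \<in> X" and k: "2 \<le> k"
  obtains v where "{u, v} \<in> edges G" "P u v 1 \<notin> X" "P u v 2 \<notin> X"
proof -
  obtain y where y: "y \<in> verts H - X" "nbhd H y \<inter> X = {Old u}"
    using X u by (auto simp: private_set_def)
  then have "y \<in> nbhd H (Old u)"
    using nbhd_sym[of "Old u" y] by blast
  then obtain v where v: "{u, v} \<in> edges G" "y = P u v 1"
    using nbhd_Old[of u] k by auto
  have "P u v 2 \<noteq> Old u" using P_eq_Old[of 2 u v u] k by auto
  then have "P u v 2 \<notin> X"
    using y(2) nbhd_inner[OF v(1), of 0] k v(2) by (auto simp: numeral_2_eq_2)
  then show thesis using that v y by blast
qed

text \<open>The inner neighbour of the last inner vertex is selected, so only \<open>Old v\<close>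
  can be its private neighbour.\<close>

lemma private_neighbour_last:
  assumes X: "private_set H X" and uv: "{u, v} \<in> edges G" and k: "0 < k"
    and Xk: "P u v k \<in> X" "P u v (k - 1) \<in> X"
  shows "Old v \<notin> X" "nbhd H (Old v) \<inter> X = {P u v k}"
proof -
  obtain y where y: "y \<in> verts H - X" "nbhd H y \<inter> X = {P u v k}"
    using X Xk by (auto simp: private_set_def)
  then have "y \<in> nbhd H (P u v k)"
    using nbhd_sym[of "P u v k" y] by blast
  then have "y = P u v (k - 1) \<or> y = Old v"
    using nbhd_inner[OF uv, of "k - 1"] k by auto
  then have "y = Old v" using y Xk by auto
  then show "Old v \<notin> X" "nbhd H (Old v) \<inter> X = {P u v k}" using y by auto
qed

lemma private_set_of_subdivision:
  assumes k: "4 dvd k" "0 < k" and X: "private_set H X"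
  obtains Y where "private_set G Y" "card X \<le> card Y + k div 2 * card (edges G)"
proof -
  have k4: "4 \<le> k" using k by (auto elim!: dvdE)
  have k_eq: "0 + 4 * Suc (k div 4 - 1) = k" "2 * Suc (k div 4 - 1) = k div 2"
    using k by (auto elim!: dvdE)
  define A where "A = {u. Old u \<in> X}"
  have subX: "X \<subseteq> verts H" using X by (simp add: private_set_def)
  then have subA: "A \<subseteq> verts G" by (auto simp: A_def verts_H)
  then have finA: "finite A" using finite_verts finite_subset by blast
  \<comment> \<open>The deficit of an edge; \<open>le_half\<close> shows that the subtraction is not
    truncated.\<close>
  define d where "d = (\<lambda>e. k div 2 - card (X \<inter> inner e))"
  have card_pair: "card (X \<inter> inner {u, v}) = card {i \<in> {0<..k}. P u v i \<in> X}"
    if "{u, v} \<in> edges G" for u v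
    using edgeD[OF that] card_Int_inner by simp
  have le_half: "card (X \<inter> inner e) \<le> k div 2" if e: "e \<in> edges G" for e
  proof -
    obtain u v where uv: "e = {u, v}" using edgeE[OF e] .
    then show ?thesis
      using private_pattern_window_le[OF private_pattern_path[OF X], of u v 0 "k div 4"] e k(1)
      by (auto simp: card_pair elim!: dvdE)
  qed
  have full: "card {i \<in> {0<..0 + 4 * Suc (k div 4 - 1)}. P u v i \<in> X} = 2 * Suc (k div 4 - 1)"
    if "{u, v} \<in> edges G" "d {u, v} = 0" for u v
    unfolding k_eq using that le_half[OF that(1)] by (auto simp: d_def card_pair)
  have "\<forall>u. \<exists>v. u \<in> A \<longrightarrow> {u, v} \<in> edges G \<and> P u v 1 \<notin> X \<and> P u v 2 \<notin> X"
    using private_neighbour_Old[OF X] k4 by (auto simp: A_def)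
  then obtain h where h: "\<And>u. u \<in> A \<Longrightarrow> {u, h u} \<in> edges G \<and> P u (h u) 1 \<notin> X \<and> P u (h u) 2 \<notin> X"
    by metis
  \<comment> \<open>The edges whose deficit can spoil the argument for \<open>u\<close>: its own
    edge to \<open>h u\<close>, and edges to a vertex outside \<open>A\<close>, which may be
    \<open>h\<close> of another vertex. An edge with both ends in \<open>A\<close> is thus charged
    to \<open>u\<close> only through \<open>h\<close>.\<close>
  define bad where "bad = (\<lambda>u e. e \<in> edges G \<and> 0 < d e \<and>
    (e = {u, h u} \<or> (\<exists>v. e = {u, v} \<and> v \<notin> A)))"
  define R where "R = {u \<in> A. \<exists>e. bad u e}"
  define g where "g = (\<lambda>u. SOME e. bad u e)"
  have g: "bad u (g u)" if "u \<in> R" for u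
    using that someI_ex[of "bad u"] by (auto simp: R_def g_def)
  have finR: "finite R" using finA by (simp add: R_def)
  \<comment> \<open>If both ends charge \<open>e\<close>, each is \<open>h\<close> of the other.
    Then the first two and the last two inner positions are unselected, and the \<open>k - 4\<close>
    positions between them contribute at most \<open>2 * (k div 4 - 1)\<close>, two below
    \<open>k div 2\<close>.\<close>
  have two: "2 \<le> d e"
    if e: "e \<in> edges G" "e = {u, v}" and uv: "u \<in> R" "v \<in> R" "g u = e" "g v = e" for e u v
  proof -
    have uvA: "u \<in> A" "v \<in> A" and neq: "u \<noteq> v" using uv e edgeD by (auto simp: R_def)
    have "h u = v" "h v = u"
      using g[OF uv(1)] g[OF uv(2)] uv uvA neq unfolding bad_def e(2) by (auto simp: doubleton_eq_iff)
    then have "P u v 1 \<notin> X" "P u v 2 \<notin> X" "P v u 1 \<notin> X" "P v u 2 \<notin> X"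
      using h uvA by metis+
    then have no: "P u v 1 \<notin> X" "P u v 2 \<notin> X" "P u v k \<notin> X" "P u v (k - 1) \<notin> X"
      using path_vertex_reverse[of k k v u] path_vertex_reverse[of "k - 1" k v u] k4 by auto
    have "{i \<in> {0<..k}. P u v i \<in> X} = {i \<in> {2<..2 + 4 * (k div 4 - 1)}. P u v i \<in> X}"
    proof -
      have "0 < i \<and> i \<le> k \<longleftrightarrow> 2 < i \<and> i \<le> k - 2" if "P u v i \<in> X" for i
      proof -
        have "i \<noteq> 1 \<and> i \<noteq> 2 \<and> i \<noteq> k \<and> i \<noteq> k - 1" using no that by metis
        then show ?thesis by arith
      qed
      moreover have "2 + 4 * (k div 4 - 1) = k - 2" using k_eq(1) by simp
      ultimately show ?thesis unfolding greaterThanAtMost_iff by auto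
    qed
    moreover have "card {i \<in> {2<..2 + 4 * (k div 4 - 1)}. P u v i \<in> X} \<le> 2 * (k div 4 - 1)"
      using k k4 e by (intro private_pattern_window_le[OF private_pattern_path[OF X]]) auto
    ultimately have "card (X \<inter> inner e) \<le> 2 * (k div 4 - 1)"
      using e card_pair by simp
    then show ?thesis
      unfolding d_def k_eq(2)[symmetric] by simp
  qed
  \<comment> \<open>Each removed vertex is charged to one edge by \<open>g\<close>, and no edge is
    charged beyond its deficit. Summing bounds \<open>card R\<close> by the total deficit.\<close>
  have fibre: "card {u \<in> R. g u = e} \<le> d e" if e: "e \<in> edges G" for e
  proof -
    obtain u v where uv: "e = {u, v}" "u \<noteq> v" using edgeE[OF e] .
    have sub: "{u \<in> R. g u = e} \<subseteq> {u, v}"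
      using g uv(1) by (auto simp: bad_def)
    have pos: "0 < d e" if "w \<in> R" "g w = e" for w
      using g[OF that(1)] that(2) by (simp add: bad_def)
    consider "{u \<in> R. g u = e} = {}" | "{u \<in> R. g u = e} = {u}" | "{u \<in> R. g u = e} = {v}"
      | "{u \<in> R. g u = e} = {u, v}" using sub by blast
    then show ?thesis
    proof cases
      case 1
      then show ?thesis by (simp only: card.empty)
    next
      case 2
      then have "u \<in> R" "g u = e" by blast+
      then show ?thesis using pos[of u] 2 by simp
    next
      case 3
      then have "v \<in> R" "g v = e" by blast+
      then show ?thesis using pos[of v] 3 by simp
    next
      case 4
      then have "u \<in> R" "v \<in> R" "g u = e" "g v = e" by blast+
      then have "2 \<le> d e" by (rule two[OF e uv(1)])
      then show ?thesis using 4 uv(2) by simp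
    qed
  qed
  have "g u \<in> edges G" if "u \<in> R" for u using g[OF that] by (simp add: bad_def)
  then have "R = (\<Union>e\<in>edges G. {u \<in> R. g u = e})" by auto
  then have "card R \<le> (\<Sum>e\<in>edges G. card {u \<in> R. g u = e})"
    using card_UN_le[OF finite_edges, of "\<lambda>e. {u \<in> R. g u = e}"] by simp
  also have "\<dots> \<le> (\<Sum>e\<in>edges G. d e)" using fibre by (rule sum_mono)
  finally have card_R: "card R \<le> sum d (edges G)" .
  have "private_set G (A - R)"
    unfolding private_set_def
  proof (intro conjI ballI)
    show "A - R \<subseteq> verts G" using subA by blast
    fix u assume "u \<in> A - R"
    then have u: "u \<in> A" "u \<notin> R" by auto
    let ?v = "h u"
    have uv: "{u, ?v} \<in> edges G" and no: "P u ?v 1 \<notin> X" "P u ?v 2 \<notin> X" using h[OF u(1)] by auto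
    have "d {u, ?v} = 0" using u uv by (auto simp: R_def bad_def)
    \<comment> \<open>The edge has no deficit and starts 00, so it ends 11, which makes
      \<open>Old (h u)\<close> the private neighbour of the last inner vertex.\<close>
    then have "P u ?v (k - 1) \<in> X \<and> P u ?v k \<in> X"
      using full_private_pattern_0011[OF private_pattern_path[OF X uv] k_eq(1) full[OF uv]] no
      by (simp only: add_0 not_False_eq_True)
    then have v: "?v \<notin> A" "nbhd H (Old ?v) \<inter> X = {P u ?v k}"
      using private_neighbour_last[OF X uv k(2)] by (auto simp: A_def)
    \<comment> \<open>As \<open>h u\<close> is outside \<open>A\<close>, a deficit on the edge from
      \<open>w\<close> would have put \<open>w\<close> into \<open>R\<close>. Without deficit,
      \<open>Old w\<close> in \<open>X\<close> forces the last inner vertex before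
      \<open>h u\<close> into \<open>X\<close>, but \<open>Old (h u)\<close> has only one neighbour
      in \<open>X\<close>.\<close>
    have "w = u" if w: "w \<in> A - R" and vw: "{?v, w} \<in> edges G" for w
    proof -
      have w: "w \<in> A - R" "{w, ?v} \<in> edges G" using w edgeD(4)[OF vw] by auto
      have "d {w, ?v} = 0" using w v(1) by (auto simp: R_def bad_def)
      then have "P w ?v k \<in> X"
        using full_private_pattern_1001[OF private_pattern_path[OF X w(2)] k_eq(1) full[OF w(2)]] w(1)
        by (simp add: A_def)
      moreover have "P w ?v k = P ?v w 1" using path_vertex_reverse[of k k ?v w] by simp
      then have "P w ?v k \<in> nbhd H (Old ?v)" using edgeD(4)[OF w(2)] k(2) by (auto simp: nbhd_Old)
      ultimately have "P w ?v k = P u ?v k" using v(2) by blast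
      then show ?thesis
        using path_vertex_inject[of w ?v u ?v k k k] edgeD(3)[OF uv] edgeD(3)[OF w(2)] k(2) by auto
    qed
    then have "nbhd G ?v \<inter> (A - R) = {u}"
      using u edgeD[OF uv] unfolding nbhd_def by blast
    then show "\<exists>y \<in> verts G - (A - R). nbhd G y \<inter> (A - R) = {u}"
      using v(1) edgeD[OF uv] by blast
  qed
  moreover have "card X \<le> card (A - R) + k div 2 * card (edges G)"
  proof -
    \<comment> \<open>The deficit missing on the edges pays for the vertices removed from
      \<open>A\<close>.\<close>
    have "(\<Sum>e\<in>edges G. card (X \<inter> inner e)) + sum d (edges G) = (\<Sum>e\<in>edges G. k div 2)"
      unfolding sum.distrib[symmetric] using le_half by (intro sum.cong) (auto simp: d_def)
    moreover have "card X = card A + (\<Sum>e\<in>edges G. card (X \<inter> inner e))"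
      unfolding A_def by (rule card_subset_verts_H[OF subX])
    moreover have "card A - card R \<le> card (A - R)"
      by (rule diff_card_le_card_Diff[OF finR])
    ultimately show ?thesis using card_R by (simp add: mult.commute)
  qed
  ultimately show thesis by (rule that)
qed

end

theorem theorem5p8:
  fixes G :: "'a graph" and k :: nat
  assumes "finite_simple_graph G"
    and "k > 0"
    and "[k = 0] (mod 4)"
  shows "super_domination_number (subdivision k G)
           = (k div 2) * card (edges G) + super_domination_number G"
proof -
  interpret subdivided_graph G k by standard fact
  have k: "4 dvd k" using assms(3) by (simp add: cong_0_iff)
  have finH: "finite_simple_graph H" using assms(1) by (rule finite_simple_graph_subdivision)
  \<comment> \<open>Written with the term \<open>k div 2 * card (edges G)\<close>, so that the final
    comparison is linear in it.\<close>
  have total: "card (verts H) = card (verts G) + 2 * (k div 2 * card (edges G))"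
    using k by (auto simp: card_verts_H elim!: dvdE)
  obtain X where X: "private_set G X" "super_domination_number G + card X = card (verts G)"
    using super_domination_number_private_set[OF assms(1)] .
  obtain X' where X': "private_set H X'" "card X' = card X + k div 2 * card (edges G)"
    using private_set_subdivision[OF k assms(2) X(1)] .
  obtain Z where Z: "private_set H Z" "super_domination_number H + card Z = card (verts H)"
    using super_domination_number_private_set[OF finH] .
  obtain Y where Y: "private_set G Y" "card Z \<le> card Y + k div 2 * card (edges G)"
    using private_set_of_subdivision[OF k assms(2) Z(1)] .
  \<comment> \<open>\<open>X'\<close> gives the upper bound for the subdivision, and
    \<open>Y\<close>, obtained from an optimal \<open>Z\<close>, gives the lower bound.\<close>
  show ?thesis
    using super_domination_number_le[OF finH X'(1)] super_domination_number_le[OF assms(1) Y(1)]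
      X(2) X'(2) Z(2) Y(2) total by linarith
qed

end
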